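(* Let $X$ be the simplicial complex on vertex set $\{0,1,\dots,9\}$ with the $14$ facets $$1249,\ 1269,\ 1569,\ 1589,\ 1489,\ 1458,\ 1457,\ 4578,\ 1256,\ 0125,\ 0256,\ 0123,\ 1234,\ 1347,$$ let $A=X|_{\{0,2,3,4,6,7,8\}}$ be the induced subcomplex of $X$ on $\{0,2,3,4,6,7,8\}$ (the complex with facets $026, 023, 234, 347, 478$), and let $Q$ be the relative simplicial complex $Q=(X,A)=X\setminus A$. Then $Q$ is not partitionable.
   Context: The notation $v_1\cdots v_k$ abbreviates the set $\{v_1,\dots,v_k\}$, e.g. $1249=\{1,2,4,9\}$. A simplicial complex is a finite collection of subsets (faces) of a finite set closed under taking subsets; its facets are its maximal faces, and the complex with given facets consists of all subsets of those facets. The induced subcomplex on $W$ is $X|_W=\{\sigma\in X : \sigma\subseteq W\}$. A relative simplicial complex is a family $\Phi=(\Delta,\Gamma):=\Delta\setminus\Gamma$ with $\Gamma$ a subcomplex of a simplicial complex $\Delta$; its facets are its inclusion-maximal elements. Here the facets of $Q$ are exactly the $14$ facets of $X$. A pure relative complex $\Phi$ (all facets of the same dimension) with facets $F_1,\dots,F_n$ is partitionable if there exist $R_1,\dots,R_n\in\Phi$ with $R_i\subseteq F_i$ such that $\Phi=\bigsqcup_{i=1}^n[R_i,F_i]$ (disjoint union), where $[R_i,F_i]=\{\sigma : R_i\subseteq\sigma\subseteq F_i\}$. *)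

theory Defs
  imports Main "HOL-Library.Disjoint_Sets"
begin

definition simplicial_complex :: "'a set set \<Rightarrow> bool" where
  "simplicial_complex \<Delta> \<longleftrightarrow>
     finite \<Delta> \<and> (\<forall>\<sigma>\<in>\<Delta>. finite \<sigma>) \<and> (\<forall>\<sigma>\<in>\<Delta>. \<forall>\<tau>. \<tau> \<subseteq> \<sigma> \<longrightarrow> \<tau> \<in> \<Delta>)"

definition facets :: "'a set set \<Rightarrow> 'a set set" where
  "facets \<Phi> = {F \<in> \<Phi>. \<forall>\<sigma>\<in>\<Phi>. F \<subseteq> \<sigma> \<longrightarrow> \<sigma> = F}"

definition complex_of_facets :: "'a set set \<Rightarrow> 'a set set" where
  "complex_of_facets \<F> = {\<sigma>. \<exists>F\<in>\<F>. \<sigma> \<subseteq> F}"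

definition induced_subcomplex :: "'a set set \<Rightarrow> 'a set \<Rightarrow> 'a set set" where
  "induced_subcomplex \<Delta> W = {\<sigma> \<in> \<Delta>. \<sigma> \<subseteq> W}"

definition relative_complex :: "'a set set \<Rightarrow> bool" where
  "relative_complex \<Phi> \<longleftrightarrow>
     (\<exists>\<Delta> \<Gamma>. simplicial_complex \<Delta> \<and> simplicial_complex \<Gamma> \<and> \<Gamma> \<subseteq> \<Delta> \<and> \<Phi> = \<Delta> - \<Gamma>)"

definition pure :: "'a set set \<Rightarrow> bool" where
  "pure \<Phi> \<longleftrightarrow> (\<forall>F\<in>facets \<Phi>. \<forall>G\<in>facets \<Phi>. card F = card G)"

text \<open>
  The notion is meant for pure relative complexes. These conditions are not conjuncts here, so
  that a family is never non-partitionable merely because it fails to be pure or relative.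
  The minimal faces are given as a function \<open>R\<close> of the facets, and \<open>{R F..F}\<close> is the interval
  in the inclusion order on sets.
\<close>

definition partitionable :: "'a set set \<Rightarrow> bool" where
  "partitionable \<Phi> \<longleftrightarrow>
     (\<exists>R. (\<forall>F\<in>facets \<Phi>. R F \<in> \<Phi> \<and> R F \<subseteq> F) \<and>
          disjoint_family_on (\<lambda>F. {R F..F}) (facets \<Phi>) \<and>
          (\<Union>F\<in>facets \<Phi>. {R F..F}) = \<Phi>)"

definition X_facets :: "nat set set" where
  "X_facets =
     {{1,2,4,9}, {1,2,6,9}, {1,5,6,9}, {1,5,8,9}, {1,4,8,9}, {1,4,5,8}, {1,4,5,7},
      {4,5,7,8}, {1,2,5,6}, {0,1,2,5}, {0,2,5,6}, {0,1,2,3}, {1,2,3,4}, {1,3,4,7}}"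

definition X :: "nat set set" where
  "X = complex_of_facets X_facets"

definition A :: "nat set set" where
  "A = induced_subcomplex X {0,2,3,4,6,7,8}"

definition Q :: "nat set set" where
  "Q = X - A"

lemma facets_complex_of_facets_minus:
  assumes card: "\<forall>F\<in>\<F>. finite F \<and> card F = k" and disj: "\<forall>F\<in>\<F>. F \<notin> \<Gamma>"
  shows "facets (complex_of_facets \<F> - \<Gamma>) = \<F>"
proof (intro equalityI subsetI)
  fix \<sigma> assume "\<sigma> \<in> facets (complex_of_facets \<F> - \<Gamma>)"
  then show "\<sigma> \<in> \<F>"
    using disj unfolding facets_def complex_of_facets_def by auto
next
  fix \<sigma> assume *: "\<sigma> \<in> \<F>"
  moreover have "\<tau> = \<sigma>" if "F \<in> \<F>" "\<tau> \<subseteq> F" "\<sigma> \<subseteq> \<tau>" for F \<tau>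
  proof -
    have "\<sigma> = F"
      using * that card by (metis card_subset_eq subset_trans)
    then show ?thesis
      using that by auto
  qed
  ultimately show "\<sigma> \<in> facets (complex_of_facets \<F> - \<Gamma>)"
    using disj unfolding facets_def complex_of_facets_def by blast
qed

lemma facets_complex_of_facets:
  assumes "\<forall>F\<in>\<F>. finite F \<and> card F = k"
  shows "facets (complex_of_facets \<F>) = \<F>"
  using facets_complex_of_facets_minus[OF assms, of "{}"] by simp

lemma induced_complex_of_facets:
  assumes "\<forall>F\<in>\<F>. \<exists>G\<in>\<G>. F \<inter> W \<subseteq> G" "\<forall>G\<in>\<G>. G \<subseteq> W \<and> (\<exists>F\<in>\<F>. G \<subseteq> F)"
  shows "induced_subcomplex (complex_of_facets \<F>) W = complex_of_facets \<G>"
proof -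
  have "(\<exists>F\<in>\<F>. \<sigma> \<subseteq> F) \<and> \<sigma> \<subseteq> W \<longleftrightarrow> (\<exists>G\<in>\<G>. \<sigma> \<subseteq> G)" for \<sigma>
    using assms by (meson Int_greatest subset_trans)
  then show ?thesis
    by (simp add: induced_subcomplex_def complex_of_facets_def)
qed

lemma simplicial_complex_of_facets:
  assumes "finite \<F>" "\<And>F. F \<in> \<F> \<Longrightarrow> finite F"
  shows "simplicial_complex (complex_of_facets \<F>)"
proof -
  have "complex_of_facets \<F> = (\<Union>F\<in>\<F>. Pow F)"
    by (auto simp: complex_of_facets_def)
  then have "finite (complex_of_facets \<F>)"
    using assms by simp
  moreover have "finite \<sigma>" if "\<sigma> \<in> complex_of_facets \<F>" for \<sigma>
    using that assms unfolding complex_of_facets_def by (auto intro: finite_subset)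
  ultimately show ?thesis
    unfolding simplicial_complex_def complex_of_facets_def by blast
qed

lemma simplicial_complex_induced:
  "simplicial_complex \<Delta> \<Longrightarrow> simplicial_complex (induced_subcomplex \<Delta> W)"
  unfolding simplicial_complex_def induced_subcomplex_def by auto

lemma X_facets_card: "F \<in> X_facets \<Longrightarrow> finite F \<and> card F = 4"
  unfolding X_facets_def by auto

lemma simplicial_complex_X: "simplicial_complex X"
proof -
  have "finite X_facets"
    by (simp add: X_facets_def)
  then show ?thesis
    unfolding X_def by (rule simplicial_complex_of_facets) (simp add: X_facets_card)
qed

lemma vertices_X: "\<Union>X = {0..9}"
proof -
  have "\<Union>X = \<Union>X_facets"
    by (auto simp: X_def complex_of_facets_def)
  also have "\<dots> = {0,1,2,3,4,5,6,7,8,9}"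
    unfolding X_facets_def by (simp only: Union_insert Union_empty) blast
  also have "\<dots> = {0..9}"
    by (simp add: set_eq_iff le_less_Suc_eq) presburger
  finally show ?thesis .
qed

lemma facets_X: "facets X = X_facets"
  unfolding X_def by (rule facets_complex_of_facets[where k = 4]) (simp add: X_facets_card)

lemma A_eq: "A = complex_of_facets {{0,2,6}, {0,2,3}, {2,3,4}, {3,4,7}, {4,7,8}}"
  unfolding A_def X_def by (rule induced_complex_of_facets) (simp_all add: X_facets_def)

lemma facets_A: "facets A = {{0,2,6}, {0,2,3}, {2,3,4}, {3,4,7}, {4,7,8}}"
  unfolding A_eq by (rule facets_complex_of_facets[where k = 3]) simp

lemma relative_complex_Q: "relative_complex Q"
proof -
  have "A \<subseteq> X"
    by (auto simp: A_def induced_subcomplex_def)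
  moreover have "simplicial_complex A"
    unfolding A_def by (rule simplicial_complex_induced[OF simplicial_complex_X])
  ultimately show ?thesis
    using simplicial_complex_X unfolding relative_complex_def Q_def by blast
qed

lemma facets_Q: "facets Q = X_facets"
proof -
  have "\<forall>F\<in>X_facets. F \<notin> A"
    unfolding X_facets_def A_def induced_subcomplex_def by simp
  then show ?thesis
    unfolding Q_def X_def
    by (rule facets_complex_of_facets_minus[where k = 4, rotated]) (simp add: X_facets_card)
qed

lemma pure_Q: "pure Q"
  by (simp add: pure_def facets_Q X_facets_card)

end

theory Submission
  imports Defs
begin

text \<open>
  A triangle of \<open>Q\<close> lying in a single facet \<open>F\<close> must contain the minimal face of \<open>F\<close>, so
  these free triangles restrict the minimal faces. In particular the edge \<open>16\<close> can then
  only be covered by \<open>1256\<close>, so the edge \<open>25\<close> is covered by \<open>0125\<close> or \<open>0256\<close>, and the free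
  triangles \<open>015\<close> and \<open>056\<close> force the vertex \<open>5\<close> into the same interval. The symmetry
  \<open>(0 7)(2 4)(6 8)\<close> of \<open>Q\<close> puts \<open>5\<close> into the interval of \<open>1457\<close> or \<open>4578\<close> as well.
\<close>

lemma mem_Q_iff:
  "\<sigma> \<in> Q \<longleftrightarrow> (\<exists>F\<in>X_facets. \<sigma> \<subseteq> F) \<and> \<not> \<sigma> \<subseteq> {0,2,3,4,6,7,8}"
  by (auto simp: Q_def A_def X_def induced_subcomplex_def complex_of_facets_def)

theorem theorem3p3:
  shows "\<not> partitionable Q"
proof
  assume "partitionable Q"
  then obtain R where
    mem: "\<And>F. F \<in> X_facets \<Longrightarrow> R F \<in> Q" and
    disj: "disjoint_family_on (\<lambda>F. {R F..F}) X_facets" and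
    cover: "(\<Union>F\<in>X_facets. {R F..F}) = Q"
    unfolding partitionable_def facets_Q by blast
  have covered: "\<exists>F\<in>X_facets. R F \<subseteq> \<sigma> \<and> \<sigma> \<subseteq> F" if "\<sigma> \<in> Q" for \<sigma>
    using that unfolding cover[symmetric] by simp
  \<comment> \<open>Every face in \<open>Q\<close> contains 1, 5 or 9, so \<open>R F\<close> cannot
    lie in two sets that meet only in vertices of \<open>A\<close>.\<close>
  have inside: False if "F \<in> X_facets" "R F \<subseteq> \<sigma>" "R F \<subseteq> \<tau>" "\<sigma> \<inter> \<tau> \<subseteq> {0,2,3,4,6,7,8}"
    for F \<sigma> \<tau>
    using mem[OF that(1)] that(2-4) unfolding mem_Q_iff by blast
  have free:
    "R {0,1,2,5} \<subseteq> {0,1,5}" "R {0,2,5,6} \<subseteq> {0,5,6}"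
    "R {1,4,5,7} \<subseteq> {1,5,7}" "R {4,5,7,8} \<subseteq> {5,7,8}"
    "R {1,2,6,9} \<subseteq> {2,6,9}" "R {1,5,6,9} \<subseteq> {5,6,9}"
    "R {1,4,8,9} \<subseteq> {4,8,9}" "R {1,5,8,9} \<subseteq> {5,8,9}"
    using covered[of "{0,1,5}"] covered[of "{0,5,6}"] covered[of "{1,5,7}"]
      covered[of "{5,7,8}"] covered[of "{2,6,9}"] covered[of "{5,6,9}"]
      covered[of "{4,8,9}"] covered[of "{5,8,9}"]
    by (simp_all add: mem_Q_iff X_facets_def)
  \<comment> \<open>Besides 1256, the edge 16 lies only in 1269 and 1569, whose free triangles 269
    and 569 meet it just in 6, a vertex of \<open>A\<close>.\<close>
  have "R {1,2,5,6} \<subseteq> {1,6}"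
    using covered[of "{1,6}"] inside[OF _ _ free(5), of "{1,6}"] inside[OF _ _ free(6), of "{1,6}"]
    by (simp add: mem_Q_iff X_facets_def) blast
  \<comment> \<open>The edges 16 and 25 are disjoint, which rules out 1256.\<close>
  then have "R {0,1,2,5} \<subseteq> {2,5} \<or> R {0,2,5,6} \<subseteq> {2,5}"
    using covered[of "{2,5}"] inside[of "{1,2,5,6}" "{1,6}" "{2,5}"]
    by (simp add: mem_Q_iff X_facets_def) blast
  then have 1: "R {0,1,2,5} \<subseteq> {5} \<or> R {0,2,5,6} \<subseteq> {5}"
    using free(1,2) by fastforce
  \<comment> \<open>The symmetry carries 16, 25 and 1256 to 18, 45 and 1458.\<close>
  have "R {1,4,5,8} \<subseteq> {1,8}"
    using covered[of "{1,8}"] inside[OF _ _ free(7), of "{1,8}"] inside[OF _ _ free(8), of "{1,8}"]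
    by (simp add: mem_Q_iff X_facets_def) blast
  then have "R {1,4,5,7} \<subseteq> {4,5} \<or> R {4,5,7,8} \<subseteq> {4,5}"
    using covered[of "{4,5}"] inside[of "{1,4,5,8}" "{1,8}" "{4,5}"]
    by (simp add: mem_Q_iff X_facets_def) blast
  then have 2: "R {1,4,5,7} \<subseteq> {5} \<or> R {4,5,7,8} \<subseteq> {5}"
    using free(3,4) by fastforce
  have unique: "F = G"
    if "F \<in> X_facets" "G \<in> X_facets" "R F \<subseteq> {5}" "R G \<subseteq> {5}" "5 \<in> F" "5 \<in> G" for F G
  proof -
    have "{5} \<in> {R F..F} \<inter> {R G..G}"
      using that by simp
    then show ?thesis
      using disjoint_family_onD[OF disj that(1,2)] by blast
  qed
  have neq: "{0,1,2,5} \<noteq> {1,4,5,7::nat}" "{0,1,2,5} \<noteq> {4,5,7,8::nat}"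
    "{0,2,5,6} \<noteq> {1,4,5,7::nat}" "{0,2,5,6} \<noteq> {4,5,7,8::nat}"
    by (simp_all add: set_eq_subset)
  show False
    using 1 2 unique[of "{0,1,2,5}" "{1,4,5,7}"] unique[of "{0,1,2,5}" "{4,5,7,8}"]
      unique[of "{0,2,5,6}" "{1,4,5,7}"] unique[of "{0,2,5,6}" "{4,5,7,8}"] neq
    by (simp add: X_facets_def) blast
qed

end
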